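(* Let $\mathcal{L}$ be a $4$-dimensional solvable Leibniz algebra over $\mathbb{C}$ whose nilradical has dimension $2$. Then $\mathcal{L}$ is isomorphic to one of the following pairwise non-isomorphic algebras, each with basis $\{e_1,e_2,x,y\}$: $$\mathcal{R}_1:\ [e_1,x]=e_1,\ [e_2,y]=e_2;$$ $$\mathcal{R}_2:\ [e_1,x]=e_1,\ [e_2,y]=e_2,\ [x,e_1]=-e_1,\ [y,e_2]=-e_2;$$ $$\mathcal{R}_3:\ [e_1,x]=e_1,\ [e_2,y]=e_2,\ [y,e_2]=-e_2.$$
   Context: A (right) Leibniz algebra over $\mathbb{C}$ is a $\mathbb{C}$-vector space $\mathcal{L}$ with a bilinear bracket $[-,-]:\mathcal{L}\times\mathcal{L}\to\mathcal{L}$ satisfying $[x,[y,z]]=[[x,y],z]-[[x,z],y]$ for all $x,y,z\in\mathcal{L}$. All algebras are finite-dimensional over $\mathbb{C}$. Define $\mathcal{L}^1=\mathcal{L}$, $\mathcal{L}^{k+1}=[\mathcal{L}^k,\mathcal{L}]$ and $\mathcal{L}^{[1]}=\mathcal{L}$, $\mathcal{L}^{[s+1]}=[\mathcal{L}^{[s]},\mathcal{L}^{[s]}]$; $\mathcal{L}$ is nilpotent (resp. solvable) if $\mathcal{L}^n=0$ for some $n$ (resp. $\mathcal{L}^{[m]}=0$ for some $m$). The nilradical of $\mathcal{L}$ is its maximal nilpotent (two-sided) ideal. In multiplication tables, products of basis elements that are not listed are zero. *)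

theory Defs
  imports "HOL-Analysis.Analysis"
begin

text \<open>The Leibniz algebra is the whole type \<^typ>\<open>'a\<close>, equipped with a complex scalar
  multiplication \<open>scale\<close>. The identity is the one for right Leibniz algebras.\<close>

locale leibniz_algebra = vector_space scale
  for scale :: "complex \<Rightarrow> 'a::ab_group_add \<Rightarrow> 'a" +
  fixes bracket :: "'a \<Rightarrow> 'a \<Rightarrow> 'a"
  assumes linear_bracket_left: "Vector_Spaces.linear scale scale (\<lambda>x. bracket x y)"
    and linear_bracket_right: "Vector_Spaces.linear scale scale (\<lambda>y. bracket x y)"
    and leibniz_identity:
      "bracket x (bracket y z) = bracket (bracket x y) z - bracket (bracket x z) y"
begin

definition bracket_sets :: "'a set \<Rightarrow> 'a set \<Rightarrow> 'a set" where
  "bracket_sets A B = span {bracket a b | a b. a \<in> A \<and> b \<in> B}"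

text \<open>Both series are indexed from 0: index \<open>k\<close> stands for \<open>A\<^sup>k\<^sup>+\<^sup>1\<close> and
  for \<open>A\<close> with bracketed exponent \<open>k + 1\<close>, respectively. They are defined for a subset \<open>A\<close>, so
  that they apply to an ideal regarded as an algebra in its own right.\<close>

primrec lower_central_series :: "'a set \<Rightarrow> nat \<Rightarrow> 'a set" where
  "lower_central_series A 0 = A"
| "lower_central_series A (Suc k) = bracket_sets (lower_central_series A k) A"

primrec derived_series :: "'a set \<Rightarrow> nat \<Rightarrow> 'a set" where
  "derived_series A 0 = A"
| "derived_series A (Suc k) = bracket_sets (derived_series A k) (derived_series A k)"

definition nilpotent :: "'a set \<Rightarrow> bool" where
  "nilpotent A \<longleftrightarrow> (\<exists>n. lower_central_series A n = {0})"

definition solvable :: "'a set \<Rightarrow> bool" where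
  "solvable A \<longleftrightarrow> (\<exists>n. derived_series A n = {0})"

definition two_sided_ideal :: "'a set \<Rightarrow> bool" where
  "two_sided_ideal I \<longleftrightarrow>
     subspace I \<and> (\<forall>a\<in>I. \<forall>x. bracket a x \<in> I \<and> bracket x a \<in> I)"

text \<open>In finite dimension the sum of two nilpotent ideals is nilpotent, so an
  inclusion-maximal nilpotent ideal is unique and contains every nilpotent ideal.\<close>

definition is_nilradical :: "'a set \<Rightarrow> bool" where
  "is_nilradical N \<longleftrightarrow> two_sided_ideal N \<and> nilpotent N \<and>
     (\<forall>I. two_sided_ideal I \<and> nilpotent I \<and> N \<subseteq> I \<longrightarrow> I = N)"

end

definition algebra_isomorphic ::
  "(complex \<Rightarrow> 'a::ab_group_add \<Rightarrow> 'a) \<Rightarrow> ('a \<Rightarrow> 'a \<Rightarrow> 'a) \<Rightarrow>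
   (complex \<Rightarrow> 'b::ab_group_add \<Rightarrow> 'b) \<Rightarrow> ('b \<Rightarrow> 'b \<Rightarrow> 'b) \<Rightarrow> bool" where
  "algebra_isomorphic scale1 bracket1 scale2 bracket2 \<longleftrightarrow>
     (\<exists>f. Vector_Spaces.linear scale1 scale2 f \<and> bij f \<and>
          (\<forall>u v. f (bracket1 u v) = bracket2 (f u) (f v)))"

text \<open>The model algebras live on \<open>complex ^ gen\<close>, whose standard basis is indexed by the
  four generators.\<close>

datatype gen = E1 | E2 | X | Y

lemma UNIV_gen: "UNIV = {E1, E2, X, Y}"
  using gen.exhaust by auto

instance gen :: finite
  by standard (simp add: UNIV_gen)

definition basis_vec :: "gen \<Rightarrow> complex ^ gen" where
  "basis_vec i = axis i 1"

definition bracket_of_table ::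
  "(gen \<Rightarrow> gen \<Rightarrow> complex ^ gen) \<Rightarrow> complex ^ gen \<Rightarrow> complex ^ gen \<Rightarrow> complex ^ gen" where
  "bracket_of_table T u v = (\<Sum>i\<in>UNIV. \<Sum>j\<in>UNIV. (u $ i * v $ j) *s T i j)"

fun table1 :: "gen \<Rightarrow> gen \<Rightarrow> complex ^ gen" where
  "table1 E1 X = basis_vec E1"
| "table1 E2 Y = basis_vec E2"
| "table1 _ _ = 0"

fun table2 :: "gen \<Rightarrow> gen \<Rightarrow> complex ^ gen" where
  "table2 E1 X = basis_vec E1"
| "table2 E2 Y = basis_vec E2"
| "table2 X E1 = - basis_vec E1"
| "table2 Y E2 = - basis_vec E2"
| "table2 _ _ = 0"

fun table3 :: "gen \<Rightarrow> gen \<Rightarrow> complex ^ gen" where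
  "table3 E1 X = basis_vec E1"
| "table3 E2 Y = basis_vec E2"
| "table3 Y E2 = - basis_vec E2"
| "table3 _ _ = 0"

definition R1 :: "complex ^ gen \<Rightarrow> complex ^ gen \<Rightarrow> complex ^ gen" where
  "R1 = bracket_of_table table1"

definition R2 :: "complex ^ gen \<Rightarrow> complex ^ gen \<Rightarrow> complex ^ gen" where
  "R2 = bracket_of_table table2"

definition R3 :: "complex ^ gen \<Rightarrow> complex ^ gen \<Rightarrow> complex ^ gen" where
  "R3 = bracket_of_table table3"

lemma linear_bracket_of_table:
  "Vector_Spaces.linear (*s) (*s) (\<lambda>u. bracket_of_table T u v)"
  "Vector_Spaces.linear (*s) (*s) (\<lambda>v. bracket_of_table T u v)"
  by (unfold_locales;
      simp add: bracket_of_table_def vec_eq_iff sum_distrib_left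
        algebra_simps flip: sum.distrib)+

lemma bracket_of_table_basis_vec:
  "bracket_of_table T (basis_vec i) (basis_vec j) = T i j"
  by (cases i; cases j)
    (simp_all add: bracket_of_table_def basis_vec_def axis_def UNIV_gen)

lemma leibniz_algebra_R1: "leibniz_algebra (*s) R1"
  unfolding R1_def
  by (intro leibniz_algebra.intro leibniz_algebra_axioms.intro
      linear_bracket_of_table vec.vector_space_axioms)
    (simp add: bracket_of_table_def UNIV_gen vec_eq_iff basis_vec_def axis_def algebra_simps)

lemma leibniz_algebra_R2: "leibniz_algebra (*s) R2"
  unfolding R2_def
  by (intro leibniz_algebra.intro leibniz_algebra_axioms.intro
      linear_bracket_of_table vec.vector_space_axioms)
    (simp add: bracket_of_table_def UNIV_gen vec_eq_iff basis_vec_def axis_def algebra_simps)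

lemma leibniz_algebra_R3: "leibniz_algebra (*s) R3"
  unfolding R3_def
  by (intro leibniz_algebra.intro leibniz_algebra_axioms.intro
      linear_bracket_of_table vec.vector_space_axioms)
    (simp add: bracket_of_table_def UNIV_gen vec_eq_iff basis_vec_def axis_def algebra_simps)

end

theory Submission
  imports Defs
begin

text \<open>
  The right multiplications of a solvable Leibniz algebra \<open>L\<close> restrict to the nilradical \<open>N\<close>, a plane,
  as a solvable Lie algebra of \<open>2 \<times> 2\<close> matrices. By Lie's theorem, which in dimension two is
  a matter of polynomial identities (\<open>solvable_sl2_invariant_line\<close>), they are simultaneously
  triangular, with two diagonal weights \<open>\<phi>\<close> and \<open>\<psi>\<close>. The weights vanish on brackets, and on \<open>N\<close> since \<open>N\<close> is
  nilpotent. An ideal that contains \<open>N\<close>, whose square lies in \<open>N\<close> and on which both weights vanish is nilpotent,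
  so it equals \<open>N\<close> by maximality. Applied along the derived series, and then to the common
  kernel of the weights, this shows that \<open>[L, L] \<subseteq> N\<close> and that \<open>N\<close> is exactly that common kernel
  (\<open>bracket_in_nilradical\<close>, \<open>vanishing_weights_in_nilradical\<close>).

  As \<open>L\<close> has dimension four, \<open>\<phi>\<close> and \<open>\<psi>\<close> are linearly independent and there are \<open>x\<close> and \<open>y\<close> dual to them.
  The off-diagonal entry of the action is then a coboundary, and a change of basis of \<open>N\<close> makes the
  action diagonal: \<open>[e1, z] = \<phi> z e1\<close> and \<open>[e2, z] = \<psi> z e2\<close>
  (\<open>diagonalisable\<close>). The Leibniz identity now leaves little freedom. Left multiplication on \<open>e1\<close> is either zero or
  given by \<open>- \<phi>\<close>, likewise on \<open>e2\<close> with \<open>- \<psi>\<close> (\<open>left_action_dichotomy\<close>), and the brackets among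
  \<open>x\<close> and \<open>y\<close> can be removed by adding elements of \<open>N\<close> to them (\<open>abelian_complement\<close>). Of the four
  resulting tables, two differ by swapping the indices.

  The three models are pairwise non-isomorphic because all squares vanish only in \<open>R2\<close>, and
  \<open>[u, [v, w]]\<close> vanishes identically in \<open>R1\<close> but not in \<open>R3\<close>.
\<close>

section \<open>Brackets, derived series and planes\<close>

context leibniz_algebra
begin

lemma bracket_add_left: "bracket (u + v) w = bracket u w + bracket v w"
  using linear_bracket_left[of w] by (simp add: Vector_Spaces.linear_iff)

lemma bracket_add_right: "bracket w (u + v) = bracket w u + bracket w v"
  using linear_bracket_right[of w] by (simp add: Vector_Spaces.linear_iff)

lemma bracket_scale_left: "bracket (scale c u) w = scale c (bracket u w)"
  using linear_bracket_left[of w] by (simp add: Vector_Spaces.linear_iff)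

lemma bracket_scale_right: "bracket w (scale c u) = scale c (bracket w u)"
  using linear_bracket_right[of w] by (simp add: Vector_Spaces.linear_iff)

lemma bracket_zero_left: "bracket 0 w = 0"
  using bracket_scale_left[of 0 0 w] by simp

lemma bracket_zero_right: "bracket w 0 = 0"
  using bracket_scale_right[of w 0 0] by simp

lemma bracket_diff_left: "bracket (u - v) w = bracket u w - bracket v w"
  using bracket_add_left[of "u - v" v w] by simp

lemma bracket_diff_right: "bracket w (u - v) = bracket w u - bracket w v"
  using bracket_add_right[of w "u - v" v] by simp

lemmas bracket_simps =
  bracket_add_left bracket_add_right bracket_scale_left bracket_scale_right
  bracket_zero_left bracket_zero_right bracket_diff_left bracket_diff_right

lemma bracket_sets_subset:
  assumes "subspace C" "\<And>a b. a \<in> A \<Longrightarrow> b \<in> B \<Longrightarrow> bracket a b \<in> C"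
  shows "bracket_sets A B \<subseteq> C"
  unfolding bracket_sets_def using assms by (intro span_minimal) auto

lemma bracket_in_bracket_sets: "a \<in> A \<Longrightarrow> b \<in> B \<Longrightarrow> bracket a b \<in> bracket_sets A B"
  unfolding bracket_sets_def by (rule span_base) auto

lemma subspace_derived_series: "subspace (derived_series UNIV k)"
  by (cases k) (simp_all add: bracket_sets_def)

text \<open>Right multiplications are derivations, which gives stability under right multiplication as for
  Lie algebras. The bracket is not antisymmetric, but the Leibniz identity itself expands
  \<open>[z, [a, b]]\<close> into brackets of elements of the previous term, so left multiplication
  is covered as well.\<close>

lemma two_sided_ideal_derived_series: "two_sided_ideal (derived_series UNIV k)"
proof (induction k)
  case 0
  then show ?case by (simp add: two_sided_ideal_def)
next
  case (Suc k)
  let ?D = "derived_series UNIV k"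
  let ?E = "derived_series UNIV (Suc k)"
  have D: "bracket a z \<in> ?D" "bracket z a \<in> ?D" if "a \<in> ?D" for a z
    using Suc that by (auto simp: two_sided_ideal_def)
  have E: "subspace ?E" by (rule subspace_derived_series)
  have E_bracket: "bracket a b \<in> ?E" if "a \<in> ?D" "b \<in> ?D" for a b
    using that by (simp add: bracket_in_bracket_sets)
  have "bracket a z \<in> ?E \<and> bracket z a \<in> ?E" if "a \<in> ?E" for a z
  proof -
    let ?G = "{a. bracket a z \<in> ?E \<and> bracket z a \<in> ?E}"
    have "subspace ?G"
      using E by (auto simp: subspace_def bracket_simps)
    moreover have "bracket a b \<in> ?G" if "a \<in> ?D" "b \<in> ?D" for a b
    proof -
      have "bracket (bracket a b) z = bracket a (bracket b z) + bracket (bracket a z) b"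
        by (simp add: leibniz_identity)
      moreover have "bracket z (bracket a b) = bracket (bracket z a) b - bracket (bracket z b) a"
        by (rule leibniz_identity)
      ultimately show ?thesis
        using E D E_bracket that by (auto intro!: subspace_add subspace_diff simp del: derived_series.simps)
    qed
    ultimately have "?E \<subseteq> ?G"
      unfolding derived_series.simps(2)[of UNIV k] by (rule bracket_sets_subset)
    then show ?thesis using that by blast
  qed
  then show ?case using E by (simp add: two_sided_ideal_def del: derived_series.simps)
qed

definition free_pair :: "'a \<Rightarrow> 'a \<Rightarrow> bool" where
  "free_pair u v \<longleftrightarrow> (\<forall>\<alpha> \<beta>. scale \<alpha> u + scale \<beta> v = 0 \<longrightarrow> \<alpha> = 0 \<and> \<beta> = 0)"

lemma free_pair_eqD:
  assumes "free_pair u v" "scale \<alpha> u + scale \<beta> v = scale \<alpha>' u + scale \<beta>' v"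
  shows "\<alpha> = \<alpha>' \<and> \<beta> = \<beta>'"
proof -
  have "scale (\<alpha> - \<alpha>') u + scale (\<beta> - \<beta>') v = 0"
    using assms(2) by (simp add: scale_left_diff_distrib algebra_simps)
  then show ?thesis using assms(1) unfolding free_pair_def by force
qed

lemma free_pair_swap: "free_pair u v \<Longrightarrow> free_pair v u"
  unfolding free_pair_def by (metis add.commute)

lemma mem_span_pair: "z \<in> span {u, v} \<longleftrightarrow> (\<exists>\<alpha> \<beta>. z = scale \<alpha> u + scale \<beta> v)"
  by (auto simp: span_insert span_empty algebra_simps)

lemma two_dim_subspace_basis:
  assumes "subspace N" "dim N = 2"
  obtains u v where "free_pair u v" "N = span {u, v}"
proof -
  obtain B where B: "B \<subseteq> N" "independent B" "N \<subseteq> span B" "card B = 2"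
    using basis_exists[of N] assms(2) by metis
  then obtain u v where uv: "B = {u, v}" "u \<noteq> v" by (meson card_2_iff)
  have "N = span {u, v}"
    using span_subspace[OF B(1,3) assms(1)] uv by simp
  moreover have "free_pair u v"
    unfolding free_pair_def
  proof (intro allI impI)
    fix \<alpha> \<beta> assume eq: "scale \<alpha> u + scale \<beta> v = 0"
    have "(\<Sum>w\<in>B. scale ((\<lambda>w. if w = u then \<alpha> else \<beta>) w) w) = 0"
      using uv eq by (simp add: algebra_simps)
    then have "\<forall>w\<in>B. (\<lambda>w. if w = u then \<alpha> else \<beta>) w = 0"
      using B(2) uv independentD[of B B "\<lambda>w. if w = u then \<alpha> else \<beta>"] by blast
    then show "\<alpha> = 0 \<and> \<beta> = 0" using uv by auto
  qed
  ultimately show ?thesis using that by blast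
qed

end

section \<open>A common eigenvector in dimension two\<close>

text \<open>The map \<open>(p, q) \<mapsto> (- p q, p\<^sup>2, - q\<^sup>2)\<close> parametrises the conic \<open>r\<^sup>2 + s t = 0\<close>.\<close>

lemma isotropic_conic_point:
  fixes r s t :: complex
  assumes "r\<^sup>2 + s * t = 0" "(r, s, t) \<noteq> (0, 0, 0)"
  obtains p q where "(p, q) \<noteq> (0, 0)" "p\<^sup>2 = s" "q\<^sup>2 = - t" "p * q = - r"
proof -
  define p q' where "p = csqrt s" and "q' = csqrt (- t)"
  have pq': "p\<^sup>2 = s" "q'\<^sup>2 = - t" by (auto simp: p_def q'_def)
  have "(p * q')\<^sup>2 = r\<^sup>2"
    using assms(1) pq' by (simp add: power_mult_distrib) algebra
  then have "p * q' = - r \<or> p * (- q') = - r" by (auto simp: power2_eq_iff)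
  moreover have "p \<noteq> 0 \<or> q' \<noteq> 0" using assms pq' by auto
  ultimately show ?thesis
    using that[of p q'] that[of p "- q'"] pq' by auto
qed

lemma binary_quadratic_form_isotropic:
  fixes r s t :: complex
  obtains p q where "(p, q) \<noteq> (0, 0)" "s * p\<^sup>2 - r * p * q - t * q\<^sup>2 = 0"
proof (cases "s = 0")
  case True
  then show ?thesis using that[of 1 0] by simp
next
  case False
  define d where "d = csqrt (r\<^sup>2 + 4 * s * t)"
  have d: "d\<^sup>2 = r\<^sup>2 + 4 * s * t" by (simp add: d_def)
  have "s * (r + d)\<^sup>2 - r * (r + d) * (2 * s) - t * (2 * s)\<^sup>2 = s * (d\<^sup>2 - r\<^sup>2 - 4 * s * t)"
    by (simp add: power2_eq_square algebra_simps)
  then show ?thesis using that[of "r + d" "2 * s"] False d by auto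
qed

text \<open>This is Lie's theorem for two-dimensional representations. If \<open>z\<close> acts on row vectors by a
  \<open>2 \<times> 2\<close> matrix with off-diagonal entries \<open>b z\<close>, \<open>c z\<close> and difference \<open>t z\<close> of the diagonal
  entries, then the conclusion says that the line through \<open>(p, q)\<close> is invariant. The assumptions
  on brackets say that \<open>\<Phi> = (t, b, c)\<close> turns the bracket into the bracket of \<open>sl\<^sub>2\<close>, which
  is the cross product \<open>(r, s, w)\<close> of the coordinate vectors, up to a twist of its entries.

  Three elements with independent images under \<open>\<Phi>\<close> have brackets with the same property,
  so they would produce such triples in every term of the derived series, contrary to solvability;
  hence all determinants of triples vanish. If all cross products vanish, then the image of \<open>\<Phi>\<close> lies on a
  line, and an eigenvector of a single matrix does. Otherwise the image lies in the plane
  orthogonal to some cross product \<open>(r, s, w)\<close>; since the plane contains the bracket that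
  this cross product represents, the cross product lies on the conic above, and a point
  \<open>(p, q)\<close> parametrising it spans the invariant line.\<close>

lemma (in leibniz_algebra) solvable_sl2_invariant_line:
  fixes t b c :: "'a \<Rightarrow> complex"
  assumes solv: "solvable UNIV"
    and zero: "t 0 = 0"
    and t: "\<And>y z. t (bracket y z) = 2 * (b y * c z - b z * c y)"
    and b: "\<And>y z. b (bracket y z) = t y * b z - t z * b y"
    and c: "\<And>y z. c (bracket y z) = c y * t z - c z * t y"
  obtains p q where "(p, q) \<noteq> (0, 0)" "\<And>z. b z * p\<^sup>2 - t z * p * q - c z * q\<^sup>2 = 0"
proof -
  have zero_bc: "b 0 = 0" "c 0 = 0"
    using b[of 0 0] c[of 0 0] by (simp_all add: bracket_zero_left)
  define r where "r = (\<lambda>y z. b y * c z - b z * c y)"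
  define s where "s = (\<lambda>y z. c y * t z - c z * t y)"
  define w where "w = (\<lambda>y z. t y * b z - t z * b y)"
  define det where "det = (\<lambda>x y z. t x * r y z + b x * s y z + c x * w y z)"
  have det0: "det x y z = 0" for x y z
  proof (rule ccontr)
    assume nz: "det x y z \<noteq> 0"
    have "\<exists>x\<in>derived_series UNIV k. \<exists>y\<in>derived_series UNIV k. \<exists>z\<in>derived_series UNIV k.
      det x y z \<noteq> 0" for k
    proof (induction k)
      case 0
      then show ?case using nz by auto
    next
      case (Suc k)
      then obtain x y z where xyz: "x \<in> derived_series UNIV k" "y \<in> derived_series UNIV k"
        "z \<in> derived_series UNIV k" and nz: "det x y z \<noteq> 0" by blast
      \<comment> \<open>The cross products of the rows form the cofactor matrix, whose determinant is the square of the original one; the twist contributes the factor \<open>- 2\<close>.\<close>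
      have "det (bracket y z) (bracket z x) (bracket x y) = - 2 * (det x y z)\<^sup>2"
        unfolding det_def r_def s_def w_def t b c by algebra
      then have "det (bracket y z) (bracket z x) (bracket x y) \<noteq> 0" using nz by simp
      then show ?case using xyz bracket_in_bracket_sets by (simp, blast)
    qed
    moreover obtain n where "derived_series UNIV n = {0}"
      using solv by (auto simp: solvable_def)
    ultimately have "det 0 0 0 \<noteq> 0" by (metis singletonD)
    then show False using zero zero_bc by (simp add: det_def)
  qed
  show ?thesis
  proof (cases "\<forall>y z. r y z = 0 \<and> s y z = 0 \<and> w y z = 0")
    case True
    show ?thesis
    proof (cases "\<forall>z. t z = 0 \<and> b z = 0 \<and> c z = 0")
      case True
      then show ?thesis using that[of 1 0] by simp
    next
      case False
      then obtain x where x: "t x \<noteq> 0 \<or> b x \<noteq> 0 \<or> c x \<noteq> 0" by blast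
      obtain p q where pq: "(p, q) \<noteq> (0, 0)" "b x * p\<^sup>2 - t x * p * q - c x * q\<^sup>2 = 0"
        by (rule binary_quadratic_form_isotropic)
      have "b z * p\<^sup>2 - t z * p * q - c z * q\<^sup>2 = 0" for z
      proof -
        let ?Q = "\<lambda>z. b z * p\<^sup>2 - t z * p * q - c z * q\<^sup>2"
        have eqs: "b x * c z = b z * c x" "c x * t z = c z * t x" "t x * b z = t z * b x"
          using True by (simp_all add: r_def s_def w_def)
        have "t x * ?Q z = t z * ?Q x" "b x * ?Q z = b z * ?Q x" "c x * ?Q z = c z * ?Q x"
          using eqs by algebra+
        then show ?thesis using x pq(2) by auto
      qed
      then show ?thesis using that pq(1) by blast
    qed
  next
    case False
    then obtain y z where yz: "(r y z, s y z, w y z) \<noteq> (0, 0, 0)" by auto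
    have "det (bracket y z) y z = 2 * ((r y z)\<^sup>2 + w y z * s y z)"
      unfolding det_def r_def s_def w_def t b c by algebra
    then have "(r y z)\<^sup>2 + s y z * w y z = 0"
      using det0[of "bracket y z" y z] by (simp only:) algebra
    then obtain p q where pq: "(p, q) \<noteq> (0, 0)" "p\<^sup>2 = s y z" "q\<^sup>2 = - w y z" "p * q = - r y z"
      using yz by (rule isotropic_conic_point)
    have "b x * p\<^sup>2 - t x * p * q - c x * q\<^sup>2 = det x y z" for x
      using pq by (simp add: det_def mult.assoc)
    then show ?thesis using that pq(1) det0 by simp
  qed
qed

section \<open>Triangular action on an ideal of dimension two\<close>

text \<open>The plane spanned by \<open>v1\<close> and \<open>v2\<close> will be the nilradical. The functionals \<open>\<phi>\<close> and \<open>\<psi>\<close> are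
  the two weights of the right action, and \<open>\<nu>\<close> measures the failure of diagonality.\<close>

locale triangular_action = leibniz_algebra +
  fixes v1 v2 :: 'a and \<phi> \<psi> \<nu> :: "'a \<Rightarrow> complex"
  assumes free: "free_pair v1 v2"
    and ideal: "two_sided_ideal (span {v1, v2})"
    and act1: "bracket v1 z = scale (\<phi> z) v1"
    and act2: "bracket v2 z = scale (\<psi> z) v2 + scale (\<nu> z) v1"

lemma (in leibniz_algebra) solvable_acts_triangularly_on_plane:
  assumes solv: "solvable UNIV" and ideal: "two_sided_ideal N" and dim: "dim N = 2"
  obtains v1 v2 \<phi> \<psi> \<nu> where "N = span {v1, v2}" "triangular_action scale bracket v1 v2 \<phi> \<psi> \<nu>"
proof -
  obtain u1 u2 where free: "free_pair u1 u2" and N: "N = span {u1, u2}"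
    using two_dim_subspace_basis ideal dim by (metis two_sided_ideal_def)
  have "u1 \<in> N" "u2 \<in> N" unfolding N by (auto intro: span_base)
  then have "\<forall>z. \<exists>\<alpha> \<beta>. bracket u1 z = scale \<alpha> u1 + scale \<beta> u2"
    "\<forall>z. \<exists>\<alpha> \<beta>. bracket u2 z = scale \<alpha> u1 + scale \<beta> u2"
    using ideal by (auto simp: two_sided_ideal_def mem_span_pair[symmetric] N)
  then obtain a b c d
    where u1: "\<And>z. bracket u1 z = scale (a z) u1 + scale (b z) u2"
      and u2: "\<And>z. bracket u2 z = scale (c z) u1 + scale (d z) u2"
    by metis
  have zero: "a 0 = 0" "d 0 = 0"
    using u1[of 0] u2[of 0] free by (auto simp: free_pair_def bracket_simps)
  have "scale (a (bracket y z)) u1 + scale (b (bracket y z)) u2 =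
      scale (b y * c z - b z * c y) u1 + scale (a y * b z + b y * d z - a z * b y - b z * d y) u2" for y z
    using leibniz_identity[of u1 y z] by (simp add: u1 u2 bracket_simps algebra_simps)
  then have ab: "a (bracket y z) = b y * c z - b z * c y"
      "b (bracket y z) = a y * b z + b y * d z - a z * b y - b z * d y" for y z
    using free_pair_eqD[OF free] by blast+
  have "scale (c (bracket y z)) u1 + scale (d (bracket y z)) u2 =
      scale (c y * a z + d y * c z - c z * a y - d z * c y) u1 + scale (c y * b z - c z * b y) u2" for y z
    using leibniz_identity[of u2 y z] by (simp add: u1 u2 bracket_simps algebra_simps)
  then have cd: "c (bracket y z) = c y * a z + d y * c z - c z * a y - d z * c y"
      "d (bracket y z) = c y * b z - c z * b y" for y z
    using free_pair_eqD[OF free] by blast+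
  obtain p q where pq: "(p, q) \<noteq> (0, 0)"
    and line: "\<And>z. b z * p\<^sup>2 - (a z - d z) * p * q - c z * q\<^sup>2 = 0"
  proof (rule solvable_sl2_invariant_line[OF solv, of "\<lambda>z. a z - d z" b c])
  qed (use zero in \<open>auto simp: ab cd algebra_simps\<close>)
  \<comment> \<open>The common eigenvector; it is completed to a basis by whichever of \<open>u1\<close>, \<open>u2\<close> is not parallel to it.\<close>
  define v1 where "v1 = scale p u1 + scale q u2"
  show ?thesis
  proof (cases "p = 0")
    case False
    have line': "p * b z + q * d z = (p * a z + q * c z) / p * q" for z
      using line[of z] False by (simp add: field_simps power2_eq_square)
    have free': "free_pair v1 u2"
      unfolding free_pair_def
    proof (intro allI impI)
      fix \<alpha> \<beta> assume "scale \<alpha> v1 + scale \<beta> u2 = 0"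
      then have "scale (\<alpha> * p) u1 + scale (\<alpha> * q + \<beta>) u2 = 0"
        by (simp add: v1_def algebra_simps)
      then show "\<alpha> = 0 \<and> \<beta> = 0" using free False unfolding free_pair_def by force
    qed
    have "u1 = scale (1 / p) v1 + scale (- q / p) u2"
      using False by (simp add: v1_def algebra_simps)
    then have "u1 \<in> span {v1, u2}" unfolding mem_span_pair by blast
    moreover have "v1 \<in> span {u1, u2}" by (auto simp: mem_span_pair v1_def)
    ultimately have N': "N = span {v1, u2}"
      unfolding N by (intro span_eq[THEN iffD2]) (auto intro: span_base)
    have "triangular_action scale bracket v1 u2 (\<lambda>z. (p * a z + q * c z) / p)
       (\<lambda>z. d z - c z / p * q) (\<lambda>z. c z / p)"
    proof (unfold_locales)
      fix z
      have "bracket v1 z = scale (p * a z + q * c z) u1 + scale (p * b z + q * d z) u2"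
        by (simp add: v1_def bracket_simps u1 u2 algebra_simps)
      then show "bracket v1 z = scale ((p * a z + q * c z) / p) v1"
        unfolding line' using False by (simp add: v1_def scale_right_distrib)
      show "bracket u2 z = scale (d z - c z / p * q) u2 + scale (c z / p) v1"
        using False by (simp add: u2 v1_def algebra_simps)
    qed (use free' ideal N' in auto)
    then show ?thesis using that N' by blast
  next
    case True
    then have q: "q \<noteq> 0" and c: "c z = 0" for z using pq line[of z] by auto
    have v1: "v1 = scale q u2" using True by (simp add: v1_def)
    have free': "free_pair v1 u1"
      using free_pair_swap[OF free] q unfolding free_pair_def v1 scale_scale by (metis mult_eq_0_iff)
    have "u2 = scale (1 / q) v1 + scale 0 u1" using q by (simp add: v1)
    then have "u2 \<in> span {v1, u1}" by (auto simp only: mem_span_pair)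
    moreover have "v1 \<in> span {u1, u2}" by (simp add: v1 span_base span_scale)
    ultimately have N': "N = span {v1, u1}"
      unfolding N by (intro span_eq[THEN iffD2]) (auto intro: span_base)
    have "triangular_action scale bracket v1 u1 d a (\<lambda>z. b z / q)"
      by unfold_locales
        (use free' ideal N' q c in \<open>auto simp: v1 bracket_simps u1 u2 algebra_simps\<close>)
    then show ?thesis using that N' by blast
  qed
qed

context triangular_action
begin

lemma weights_zero: "\<phi> 0 = 0" "\<psi> 0 = 0" "\<nu> 0 = 0"
  using act1[of 0] act2[of 0] free unfolding free_pair_def bracket_simps
  by (metis add.commute add_0 scale_zero_left)+

lemma weights_add:
  "\<phi> (y + z) = \<phi> y + \<phi> z" "\<psi> (y + z) = \<psi> y + \<psi> z" "\<nu> (y + z) = \<nu> y + \<nu> z"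
proof -
  have "scale (\<phi> (y + z)) v1 + scale 0 v2 = scale (\<phi> y + \<phi> z) v1 + scale 0 v2"
    using bracket_add_right[of v1 y z] by (simp add: act1 algebra_simps)
  then show "\<phi> (y + z) = \<phi> y + \<phi> z" using free_pair_eqD[OF free] by blast
  have "scale (\<nu> (y + z)) v1 + scale (\<psi> (y + z)) v2 = scale (\<nu> y + \<nu> z) v1 + scale (\<psi> y + \<psi> z) v2"
    using bracket_add_right[of v2 y z] by (simp add: act2 algebra_simps)
  then show "\<psi> (y + z) = \<psi> y + \<psi> z" "\<nu> (y + z) = \<nu> y + \<nu> z"
    using free_pair_eqD[OF free] by blast+
qed

lemma weights_scale:
  "\<phi> (scale k z) = k * \<phi> z" "\<psi> (scale k z) = k * \<psi> z" "\<nu> (scale k z) = k * \<nu> z"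
proof -
  have "scale (\<phi> (scale k z)) v1 + scale 0 v2 = scale (k * \<phi> z) v1 + scale 0 v2"
    using bracket_scale_right[of v1 k z] by (simp add: act1 algebra_simps)
  then show "\<phi> (scale k z) = k * \<phi> z" using free_pair_eqD[OF free] by blast
  have "scale (\<nu> (scale k z)) v1 + scale (\<psi> (scale k z)) v2 = scale (k * \<nu> z) v1 + scale (k * \<psi> z) v2"
    using bracket_scale_right[of v2 k z] by (simp add: act2 algebra_simps)
  then show "\<psi> (scale k z) = k * \<psi> z" "\<nu> (scale k z) = k * \<nu> z"
    using free_pair_eqD[OF free] by blast+
qed

lemma weights_diff: "\<phi> (y - z) = \<phi> y - \<phi> z" "\<psi> (y - z) = \<psi> y - \<psi> z"
  using weights_add[of "y - z" z] by simp_all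

text \<open>The commutator of two upper triangular matrices is strictly upper triangular.\<close>

lemma weights_bracket:
  "\<phi> (bracket y z) = 0" "\<psi> (bracket y z) = 0"
  "\<nu> (bracket y z) = (\<phi> z - \<psi> z) * \<nu> y - (\<phi> y - \<psi> y) * \<nu> z"
proof -
  have "scale (\<phi> (bracket y z)) v1 + scale 0 v2 = scale 0 v1 + scale 0 v2"
    using leibniz_identity[of v1 y z] by (simp add: act1 bracket_simps algebra_simps)
  then show "\<phi> (bracket y z) = 0" using free_pair_eqD[OF free] by blast
  have "scale (\<nu> (bracket y z)) v1 + scale (\<psi> (bracket y z)) v2
     = scale ((\<phi> z - \<psi> z) * \<nu> y - (\<phi> y - \<psi> y) * \<nu> z) v1 + scale 0 v2"
    using leibniz_identity[of v2 y z] by (simp add: act1 act2 bracket_simps algebra_simps)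
  then show "\<psi> (bracket y z) = 0"
    "\<nu> (bracket y z) = (\<phi> z - \<psi> z) * \<nu> y - (\<phi> y - \<psi> y) * \<nu> z"
    using free_pair_eqD[OF free] by blast+
qed

lemma v1_in: "v1 \<in> span {v1, v2}" and v2_in: "v2 \<in> span {v1, v2}"
  by (auto intro: span_base)

text \<open>A nonzero weight at \<open>n\<close> would make right multiplication by \<open>n\<close> reproduce, up to a scalar,
  \<open>v1\<close> in the case of \<open>\<phi>\<close> and \<open>v2\<close> modulo \<open>v1\<close> in the case of \<open>\<psi>\<close>, so that no term of the lower
  central series could vanish.\<close>

lemma weights_vanish_on_nilpotent_plane:
  assumes nil: "nilpotent (span {v1, v2})" and n: "n \<in> span {v1, v2}"
  shows "\<phi> n = 0" "\<psi> n = 0"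
proof -
  let ?C = "lower_central_series (span {v1, v2})"
  obtain m where m: "?C m = {0}" using nil by (auto simp: nilpotent_def)
  have subspace_C: "subspace (?C k)" for k
    by (cases k) (simp_all add: bracket_sets_def)
  have step: "scale (inverse \<alpha>) (bracket u n) \<in> ?C (Suc k)" if "u \<in> ?C k" for u k \<alpha>
    using bracket_in_bracket_sets[OF that n] subspace_C[of "Suc k"] by (auto intro: subspace_scale)
  show "\<phi> n = 0"
  proof (rule ccontr)
    assume nz: "\<phi> n \<noteq> 0"
    have "v1 \<in> ?C k" for k
    proof (induction k)
      case 0
      show ?case using v1_in by simp
    next
      case (Suc k)
      show ?case using step[OF Suc, of "\<phi> n"] nz by (simp add: act1)
    qed
    then have "v1 = 0" using m by blast
    then show False using free unfolding free_pair_def by (metis add_0 scale_zero_left scale_zero_right zero_neq_one)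
  qed
  show "\<psi> n = 0"
  proof (rule ccontr)
    assume nz: "\<psi> n \<noteq> 0"
    have "\<exists>\<gamma>. v2 + scale \<gamma> v1 \<in> ?C k" for k
    proof (induction k)
      case 0
      have "v2 + scale 0 v1 \<in> ?C 0" using v2_in by simp
      then show ?case ..
    next
      case (Suc k)
      then obtain \<gamma> where "v2 + scale \<gamma> v1 \<in> ?C k" by blast
      from step[OF this, of "\<psi> n"]
      have "v2 + scale (inverse (\<psi> n) * (\<nu> n + \<gamma> * \<phi> n)) v1 \<in> ?C (Suc k)"
        using nz by (simp add: act1 act2 bracket_simps algebra_simps)
      then show ?case ..
    qed
    then obtain \<gamma> where "v2 + scale \<gamma> v1 = 0" using m by blast
    then have "scale \<gamma> v1 + scale 1 v2 = 0" by (simp add: add.commute)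
    then show False using free unfolding free_pair_def by (metis zero_neq_one)
  qed
qed

section \<open>The nilradical as the common kernel of the weights\<close>

text \<open>The lower central series of \<open>A\<close> descends along the flag \<open>A\<close>, plane, line through \<open>v1\<close>, zero.\<close>

lemma nilpotent_of_vanishing_weights:
  assumes sub: "span {v1, v2} \<subseteq> A"
    and sq: "\<And>a b. a \<in> A \<Longrightarrow> b \<in> A \<Longrightarrow> bracket a b \<in> span {v1, v2}"
    and van: "\<And>a. a \<in> A \<Longrightarrow> \<phi> a = 0 \<and> \<psi> a = 0"
  shows "nilpotent A"
proof -
  have C1: "lower_central_series A 1 \<subseteq> span {v1, v2}"
    using sq by (simp add: bracket_sets_subset)
  have C2: "lower_central_series A 2 \<subseteq> span {v1}"
    unfolding numeral_2_eq_2 lower_central_series.simps(2)[of A "Suc 0"]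
  proof (rule bracket_sets_subset)
    fix a b assume "a \<in> lower_central_series A (Suc 0)" "b \<in> A"
    then obtain \<alpha> \<beta> where "a = scale \<alpha> v1 + scale \<beta> v2" using C1 mem_span_pair[of a v1 v2] by (simp only: One_nat_def) blast
    then have "bracket a b = scale (\<beta> * \<nu> b) v1"
      using van[OF \<open>b \<in> A\<close>] by (simp add: act1 act2 bracket_simps)
    then show "bracket a b \<in> span {v1}" by (simp add: span_base span_scale)
  qed simp
  have "lower_central_series A 3 \<subseteq> {0}"
    unfolding numeral_3_eq_3 lower_central_series.simps(2)[of A "Suc (Suc 0)"]
  proof (rule bracket_sets_subset)
    fix a b assume "a \<in> lower_central_series A (Suc (Suc 0))" "b \<in> A"
    then obtain \<alpha> where "a = scale \<alpha> v1" using C2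
      by (auto simp: numeral_2_eq_2 span_singleton)
    then show "bracket a b \<in> {0}" using van[OF \<open>b \<in> A\<close>] by (simp add: act1 bracket_simps)
  qed simp
  moreover have "0 \<in> lower_central_series A 3"
    by (simp add: numeral_3_eq_3 bracket_sets_def span_zero)
  ultimately have "lower_central_series A 3 = {0}" by blast
  then show ?thesis unfolding nilpotent_def by blast
qed

text \<open>The maximality of the nilradical enters the classification only through this lemma.\<close>

lemma nilradical_absorbs:
  assumes rad: "is_nilradical (span {v1, v2})" and A: "two_sided_ideal A"
    and sub: "span {v1, v2} \<subseteq> A"
    and sq: "\<And>a b. a \<in> A \<Longrightarrow> b \<in> A \<Longrightarrow> bracket a b \<in> span {v1, v2}"
    and van: "\<And>a. a \<in> A \<Longrightarrow> \<phi> a = 0 \<and> \<psi> a = 0"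
  shows "A = span {v1, v2}"
  using nilpotent_of_vanishing_weights[OF sub sq van] rad A sub
  unfolding is_nilradical_def by blast

text \<open>The terms of the derived series are shown to lie in the nilradical \<open>N\<close> one after the other, going
  backwards from the vanishing one. If \<open>D\<close> is a term after the initial one and the next
  term lies in \<open>N\<close>, then \<open>N + D\<close> is an ideal with square in \<open>N\<close> on which both weights
  vanish, so it is absorbed by \<open>N\<close>. The induction ends at the first derived term, because the
  weights need not vanish on the whole algebra.\<close>

lemma bracket_in_nilradical:
  assumes solv: "solvable UNIV" and rad: "is_nilradical (span {v1, v2})"
  shows "bracket y z \<in> span {v1, v2}"
proof -
  let ?N = "span {v1, v2}" and ?D = "derived_series UNIV"
  have van_N: "\<phi> n = 0 \<and> \<psi> n = 0" if "n \<in> ?N" for n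
    using weights_vanish_on_nilpotent_plane rad that by (auto simp: is_nilradical_def)
  have van_D: "\<phi> a = 0 \<and> \<psi> a = 0" if "a \<in> ?D (Suc k)" for a k
  proof -
    have "subspace {a. \<phi> a = 0 \<and> \<psi> a = 0}"
      by (auto simp: subspace_def weights_zero weights_add weights_scale)
    then have "?D (Suc k) \<subseteq> {a. \<phi> a = 0 \<and> \<psi> a = 0}"
      unfolding derived_series.simps by (rule bracket_sets_subset) (simp add: weights_bracket)
    then show ?thesis using that by blast
  qed
  have descend: "?D (Suc k) \<subseteq> ?N" if IH: "?D (Suc (Suc k)) \<subseteq> ?N" for k
  proof -
    let ?A = "{n + d | n d. n \<in> ?N \<and> d \<in> ?D (Suc k)}"
    have D: "two_sided_ideal (?D (Suc k))" by (rule two_sided_ideal_derived_series)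
    have "subspace ?A"
      by (rule subspace_sums) (use subspace_derived_series in blast)+
    moreover have "bracket a z \<in> ?A \<and> bracket z a \<in> ?A" if a: "a \<in> ?A" for a z
    proof -
      obtain n d where nd: "a = n + d" "n \<in> ?N" "d \<in> ?D (Suc k)" using a by blast
      have "bracket n z \<in> ?N" "bracket z n \<in> ?N"
        "bracket d z \<in> ?D (Suc k)" "bracket z d \<in> ?D (Suc k)"
        using ideal D nd unfolding two_sided_ideal_def by blast+
      then show ?thesis unfolding nd(1) bracket_simps by blast
    qed
    ultimately have A: "two_sided_ideal ?A" by (simp add: two_sided_ideal_def)
    have sub: "?N \<subseteq> ?A"
    proof
      fix n assume "n \<in> ?N"
      then have "n + 0 \<in> ?A" using subspace_0[OF subspace_derived_series] by blast
      then show "n \<in> ?A" by simp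
    qed
    have sq: "bracket a b \<in> ?N" if a: "a \<in> ?A" and b: "b \<in> ?A" for a b
    proof -
      obtain n d where a: "a = n + d" "n \<in> ?N" "d \<in> ?D (Suc k)" using a by blast
      obtain m e where b: "b = m + e" "m \<in> ?N" "e \<in> ?D (Suc k)" using b by blast
      have "bracket d e \<in> ?D (Suc (Suc k))"
        unfolding derived_series.simps(2)[of UNIV "Suc k"]
        using a b by (intro bracket_in_bracket_sets)
      then have "bracket d e \<in> ?N" using IH by blast
      moreover have "bracket n m \<in> ?N" "bracket n e \<in> ?N" "bracket d m \<in> ?N"
        using ideal a b by (auto simp: two_sided_ideal_def)
      ultimately show ?thesis unfolding a b bracket_simps by (intro span_add)
    qed
    have van: "\<phi> a = 0 \<and> \<psi> a = 0" if "a \<in> ?A" for a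
      using that van_N van_D by (auto simp: weights_add simp del: derived_series.simps)
    have "?A = ?N" by (rule nilradical_absorbs[OF rad A sub sq van])
    moreover have "?D (Suc k) \<subseteq> ?A"
    proof
      fix d assume "d \<in> ?D (Suc k)"
      then have "0 + d \<in> ?A" using span_zero by blast
      then show "d \<in> ?A" by simp
    qed
    ultimately show ?thesis by blast
  qed
  obtain n where n: "?D n = {0}" using solv by (auto simp: solvable_def)
  then have "?D (Suc n) \<subseteq> ?N" by (auto simp: bracket_sets_def bracket_simps span_zero)
  then have "?D (Suc 0) \<subseteq> ?N"
    by (induction n) (use descend in blast)+
  then show ?thesis using bracket_in_bracket_sets[of y UNIV z UNIV] by auto
qed

text \<open>The common kernel of the weights is an ideal because it contains all brackets, and its square lies
  in the nilradical by the previous lemma.\<close>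

lemma vanishing_weights_in_nilradical:
  assumes solv: "solvable UNIV" and rad: "is_nilradical (span {v1, v2})"
    and "\<phi> z = 0" "\<psi> z = 0"
  shows "z \<in> span {v1, v2}"
proof -
  let ?K = "{z. \<phi> z = 0 \<and> \<psi> z = 0}"
  have "two_sided_ideal ?K"
    by (auto simp: two_sided_ideal_def subspace_def weights_zero weights_add weights_scale weights_bracket)
  moreover have "span {v1, v2} \<subseteq> ?K"
    using weights_vanish_on_nilpotent_plane rad by (auto simp: is_nilradical_def)
  ultimately have "?K = span {v1, v2}"
    by (rule nilradical_absorbs[OF rad]) (use bracket_in_nilradical[OF solv rad] in auto)
  then show ?thesis using assms by blast
qed

text \<open>If the weights were linearly dependent, then the algebra would be spanned by the nilradical and one
  more element \<open>w\<close>, which is impossible in dimension four.\<close>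

lemma weights_dual_basis:
  assumes solv: "solvable UNIV" and rad: "is_nilradical (span {v1, v2})"
    and dim: "dim (UNIV :: 'a set) = 4"
  obtains x y where "\<phi> x = 1" "\<psi> x = 0" "\<phi> y = 0" "\<psi> y = 1"
proof -
  have "\<exists>y z. \<phi> y * \<psi> z - \<phi> z * \<psi> y \<noteq> 0"
  proof (rule ccontr)
    assume "\<not> ?thesis"
    then have proportional: "\<phi> y * \<psi> z = \<phi> z * \<psi> y" for y z by simp
    obtain w where w: "\<And>z. \<exists>c. \<phi> z = c * \<phi> w \<and> \<psi> z = c * \<psi> w"
    proof (cases "\<exists>w. \<phi> w \<noteq> 0 \<or> \<psi> w \<noteq> 0")
      case True
      then obtain w where w: "\<phi> w \<noteq> 0 \<or> \<psi> w \<noteq> 0" by blast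
      have "\<exists>k. \<phi> z = k * \<phi> w \<and> \<psi> z = k * \<psi> w" for z
      proof (cases "\<phi> w = 0")
        case True
        then show ?thesis using w proportional[of w z] by (intro exI[of _ "\<psi> z / \<psi> w"]) auto
      next
        case False
        then show ?thesis using proportional[of w z] by (intro exI[of _ "\<phi> z / \<phi> w"]) (simp add: field_simps)
      qed
      then show ?thesis using that by blast
    next
      case False
      then show ?thesis using that[of 0] by auto
    qed
    have "z \<in> span {w, v1, v2}" for z
    proof -
      obtain c where "\<phi> z = c * \<phi> w" "\<psi> z = c * \<psi> w" using w by blast
      then have "z - scale c w \<in> span {v1, v2}"
        by (intro vanishing_weights_in_nilradical[OF solv rad]) (simp_all add: weights_diff weights_scale)
      then show ?thesis unfolding span_insert[of w] by blast
    qed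
    then have "dim (UNIV :: 'a set) \<le> card {w, v1, v2}" by (intro dim_le_card) auto
    also have "\<dots> \<le> 3" by (simp add: card_insert_if)
    finally show False using dim by simp
  qed
  then obtain y z where nz: "\<phi> y * \<psi> z - \<phi> z * \<psi> y \<noteq> 0" by blast
  \<comment> \<open>Cramer's rule.\<close>
  define k where "k = inverse (\<phi> y * \<psi> z - \<phi> z * \<psi> y)"
  have k: "k * (\<phi> y * \<psi> z - \<phi> z * \<psi> y) = 1" using nz by (simp add: k_def)
  show ?thesis
    by (rule that[of "scale (k * \<psi> z) y - scale (k * \<psi> y) z" "scale (k * \<phi> y) z - scale (k * \<phi> z) y"])
      (use k in \<open>simp_all add: weights_diff weights_scale algebra_simps\<close>)
qed

end

section \<open>The diagonal form of the right action\<close>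

locale diagonal_action = triangular_action scale bracket e1 e2 \<phi> \<psi> "\<lambda>_. 0"
  for scale :: "complex \<Rightarrow> 'a::ab_group_add \<Rightarrow> 'a" and bracket e1 e2 \<phi> \<psi> +
  fixes x y :: 'a
  assumes dual: "\<phi> x = 1" "\<psi> x = 0" "\<phi> y = 0" "\<psi> y = 1"
    and bracket_in_plane: "bracket u v \<in> span {e1, e2}"
    and vanishing_weights: "\<phi> z = 0 \<Longrightarrow> \<psi> z = 0 \<Longrightarrow> z \<in> span {e1, e2}"

text \<open>Evaluating the cocycle identity of \<open>\<nu>\<close> from \<open>weights_bracket\<close> at elements of the plane gives
  \<open>\<nu> = 0\<close> there, hence \<open>\<nu> = \<nu> x \<cdot> (\<phi> - \<psi>)\<close> everywhere. This is the coboundary removed by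
  subtracting \<open>\<nu> x\<close> times \<open>v1\<close> from \<open>v2\<close>.\<close>

lemma (in triangular_action) diagonalisable:
  assumes dual: "\<phi> x = 1" "\<psi> x = 0" "\<phi> y = 0" "\<psi> y = 1"
    and inp: "\<And>u v. bracket u v \<in> span {v1, v2}"
    and ker: "\<And>z. \<phi> z = 0 \<Longrightarrow> \<psi> z = 0 \<Longrightarrow> z \<in> span {v1, v2}"
  shows "diagonal_action scale bracket v1 (v2 - scale (\<nu> x) v1) \<phi> \<psi> x y"
proof -
  let ?w = "v2 - scale (\<nu> x) v1"
  have plane: "span {v1, ?w} = span {v1, v2}"
  proof -
    have "v2 = scale (\<nu> x) v1 + scale 1 ?w" "?w = scale (- \<nu> x) v1 + scale 1 v2" by simp_all
    then have "v2 \<in> span {v1, ?w}" "?w \<in> span {v1, v2}" unfolding mem_span_pair by blast+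
    then show ?thesis by (intro span_eq[THEN iffD2]) (auto intro: span_base)
  qed
  have nu1: "\<nu> v1 = 0"
    using weights_bracket(3)[of v1 y] weights_bracket(1,2)[of v1 x] by (simp add: act1 dual weights_zero)
  have nu2: "\<nu> v2 = 0"
    using weights_bracket(3)[of v2 x] weights_bracket(1,2)[of v1 x] weights_bracket(1,2)[of v2 y] nu1
    by (simp add: act1 act2 dual weights_scale weights_add)
  have "\<nu> (bracket z x) = 0" for z
    using inp[of z x] nu1 nu2 by (auto simp: mem_span_pair weights_add weights_scale)
  then have nu: "\<nu> z = (\<phi> z - \<psi> z) * \<nu> x" for z
    using weights_bracket(3)[of z x] by (simp add: dual)
  show ?thesis
  proof (unfold_locales)
    show "free_pair v1 ?w"
      unfolding free_pair_def
    proof (intro allI impI)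
      fix \<alpha> \<beta> assume "scale \<alpha> v1 + scale \<beta> ?w = 0"
      then have "scale (\<alpha> - \<beta> * \<nu> x) v1 + scale \<beta> v2 = 0" by (simp add: algebra_simps)
      then show "\<alpha> = 0 \<and> \<beta> = 0" using free unfolding free_pair_def by force
    qed
    show "bracket ?w z = scale (\<psi> z) ?w + scale 0 v1" for z
      by (simp add: bracket_simps act1 act2 nu[of z] algebra_simps)
  qed (use ideal act1 dual inp ker plane in auto)
qed

context diagonal_action
begin

text \<open>By this symmetry, every statement about first coordinates below also yields one about second
  coordinates.\<close>

lemma swap: "diagonal_action scale bracket e2 e1 \<psi> \<phi> y x"
  by unfold_locales
    (use free_pair_swap[OF free] ideal act1 act2 dual bracket_in_plane vanishing_weights
     in \<open>auto simp: insert_commute\<close>)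

lemma weights_plane: "\<phi> e1 = 0" "\<psi> e1 = 0" "\<phi> e2 = 0" "\<psi> e2 = 0"
  using weights_bracket(1,2)[of e1 x] weights_bracket(1,2)[of e2 y] by (simp_all add: act1 act2 dual)

section \<open>The left action and a complement with zero brackets\<close>

text \<open>A single constant suffices: the second coordinate of a bracket is the constant of the same name for
  the swapped data.\<close>

definition coord :: "'a \<Rightarrow> 'a \<Rightarrow> complex" where
  "coord u v = (THE \<alpha>. \<exists>\<beta>. bracket u v = scale \<alpha> e1 + scale \<beta> e2)"

lemma coord_eqI: "bracket u v = scale \<alpha> e1 + scale \<beta> e2 \<Longrightarrow> coord u v = \<alpha>"
  unfolding coord_def using free_pair_eqD[OF free] by (intro the_equality) auto

lemma bracket_coord: obtains \<beta> where "bracket u v = scale (coord u v) e1 + scale \<beta> e2"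
  using bracket_in_plane[of u v] coord_eqI unfolding mem_span_pair by metis

lemma coord_linear:
  "coord (u + v) w = coord u w + coord v w" "coord w (u + v) = coord w u + coord w v"
  "coord (scale k u) w = k * coord u w" "coord w (scale k u) = k * coord w u"
  "coord (u - v) w = coord u w - coord v w" "coord w (u - v) = coord w u - coord w v"
proof -
  obtain a where a: "bracket u w = scale (coord u w) e1 + scale a e2" by (rule bracket_coord)
  obtain b where b: "bracket v w = scale (coord v w) e1 + scale b e2" by (rule bracket_coord)
  obtain c where c: "bracket w u = scale (coord w u) e1 + scale c e2" by (rule bracket_coord)
  obtain d where d: "bracket w v = scale (coord w v) e1 + scale d e2" by (rule bracket_coord)
  show "coord (u + v) w = coord u w + coord v w"
    by (rule coord_eqI[where \<beta> = "a + b"]) (simp add: bracket_simps a b algebra_simps)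
  show "coord w (u + v) = coord w u + coord w v"
    by (rule coord_eqI[where \<beta> = "c + d"]) (simp add: bracket_simps c d algebra_simps)
  show "coord (scale k u) w = k * coord u w"
    by (rule coord_eqI[where \<beta> = "k * a"]) (simp add: bracket_simps a algebra_simps)
  show "coord w (scale k u) = k * coord w u"
    by (rule coord_eqI[where \<beta> = "k * c"]) (simp add: bracket_simps c algebra_simps)
  show "coord (u - v) w = coord u w - coord v w"
    by (rule coord_eqI[where \<beta> = "a - b"]) (simp add: bracket_simps a b algebra_simps)
  show "coord w (u - v) = coord w u - coord w v"
    by (rule coord_eqI[where \<beta> = "c - d"]) (simp add: bracket_simps c d algebra_simps)
qed

lemma coord_plane_left: "coord e1 z = \<phi> z" "coord e2 z = 0"
  using coord_eqI[of e1 z "\<phi> z" 0] coord_eqI[of e2 z 0 "\<psi> z"] by (simp_all add: act1 act2)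

text \<open>The first coordinate of the Leibniz identity.\<close>

lemma coord_leibniz: "coord z (bracket u v) = coord z u * \<phi> v - coord z v * \<phi> u"
proof -
  obtain a where a: "bracket z u = scale (coord z u) e1 + scale a e2" by (rule bracket_coord)
  obtain b where b: "bracket z v = scale (coord z v) e1 + scale b e2" by (rule bracket_coord)
  show ?thesis
    by (rule coord_eqI[where \<beta> = "a * \<psi> v - b * \<psi> u"])
      (simp add: leibniz_identity a b bracket_simps act1 act2 algebra_simps)
qed

lemma coord_e2_right: "coord z e2 = 0"
  using coord_leibniz[of z e2 y] by (simp add: act2 dual weights_plane)

lemma coord_bracket_right: "coord z (bracket u v) = coord u v * coord z e1"
proof -
  obtain \<beta> where "bracket u v = scale (coord u v) e1 + scale \<beta> e2" by (rule bracket_coord)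
  then show ?thesis by (simp add: coord_linear coord_e2_right)
qed

text \<open>Comparing the two expressions for the first coordinate of \<open>[z, [u, e1]]\<close> gives
  \<open>l z \<cdot> (l u + \<phi> u) = 0\<close> for all \<open>z\<close> and \<open>u\<close>, where \<open>l z = coord z e1\<close>. This identity is where the
  algebra splits into several isomorphism types.\<close>

lemma coord_e1_dichotomy: "(\<forall>z. coord z e1 = 0) \<or> (\<forall>z. coord z e1 = - \<phi> z)"
proof -
  have "coord z e1 * (coord u e1 + \<phi> u) = 0" for z u
    using coord_leibniz[of z u e1] by (simp add: coord_bracket_right weights_plane algebra_simps)
  then show ?thesis by (metis mult_eq_0_iff add_eq_0_iff2 add_eq_0_iff)
qed

text \<open>If \<open>e1\<close> is killed from the left, then \<open>coord u v = coord u x \<cdot> \<phi> v\<close>; if it is acted on by \<open>- \<phi>\<close>, then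
  \<open>coord\<close> is alternating on \<open>x\<close> and \<open>y\<close>, with the single parameter \<open>coord y x\<close>. In both cases the same shift
  along \<open>e1\<close> makes the first coordinates vanish. The shift along \<open>e2\<close> does not
  affect them and is left arbitrary, so that both coordinates can be treated at once.\<close>

lemma coord_normalised:
  fixes \<beta> \<gamma> :: complex
  defines "x' \<equiv> x - scale (coord x x) e1 - scale \<beta> e2"
    and "y' \<equiv> y - scale (coord y x) e1 - scale \<gamma> e2"
  shows "coord x' x' = 0 \<and> coord x' y' = 0 \<and> coord y' x' = 0 \<and> coord y' y' = 0"
proof -
  have id: "coord z u * \<phi> v - coord z v * \<phi> u = coord u v * coord z e1" for z u v
    using coord_leibniz coord_bracket_right by metis
  show ?thesis
    using coord_e1_dichotomy
  proof
    assume "\<forall>z. coord z e1 = 0"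
    then show ?thesis
      using id[of x y x] id[of y y x]
      by (simp add: x'_def y'_def coord_linear coord_plane_left coord_e2_right dual weights_plane)
  next
    assume "\<forall>z. coord z e1 = - \<phi> z"
    then show ?thesis
      using id[of x x x] id[of x y x] id[of y x x] id[of y y x] id[of x y y] id[of x x y]
      by (simp add: x'_def y'_def weights_diff weights_scale coord_linear coord_plane_left coord_e2_right dual weights_plane)
  qed
qed

text \<open>The second coordinate vanishes by the swapped form of \<open>coord_e2_right\<close>.\<close>

lemma bracket_e1_right: "bracket z e1 = scale (coord z e1) e1"
proof -
  interpret s: diagonal_action scale bracket e2 e1 \<psi> \<phi> y x by (rule swap)
  obtain \<beta> where \<beta>: "bracket z e1 = scale (coord z e1) e1 + scale \<beta> e2" by (rule bracket_coord)
  then have "s.coord z e1 = \<beta>"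
    by (intro s.coord_eqI[where \<beta> = "coord z e1"]) (simp add: add.commute)
  then show ?thesis using \<beta> s.coord_e2_right by simp
qed

lemma left_action_dichotomy: "(\<forall>z. bracket z e1 = 0) \<or> (\<forall>z. bracket z e1 = - scale (\<phi> z) e1)"
  using coord_e1_dichotomy by (auto simp: bracket_e1_right)

lemma abelian_complement:
  obtains x' y' where "diagonal_action scale bracket e1 e2 \<phi> \<psi> x' y'"
    "bracket x' x' = 0" "bracket x' y' = 0" "bracket y' x' = 0" "bracket y' y' = 0"
proof -
  interpret s: diagonal_action scale bracket e2 e1 \<psi> \<phi> y x by (rule swap)
  define x' where "x' = x - scale (coord x x) e1 - scale (s.coord x y) e2"
  define y' where "y' = y - scale (coord y x) e1 - scale (s.coord y y) e2"
  have s_eq: "x' = x - scale (s.coord x y) e2 - scale (coord x x) e1"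
    "y' = y - scale (s.coord y y) e2 - scale (coord y x) e1"
    by (simp_all add: x'_def y'_def algebra_simps)
  have vanish: "bracket u v = 0" if 0: "coord u v = 0" "s.coord u v = 0" for u v
  proof -
    obtain \<beta> where \<beta>: "bracket u v = scale (coord u v) e1 + scale \<beta> e2" by (rule bracket_coord)
    then have "s.coord u v = \<beta>"
      by (intro s.coord_eqI[where \<beta> = "coord u v"]) (simp add: add.commute)
    then show ?thesis using \<beta> 0 by simp
  qed
  have "diagonal_action scale bracket e1 e2 \<phi> \<psi> x' y'"
    by unfold_locales
      (use bracket_in_plane vanishing_weights in
       \<open>simp_all add: x'_def y'_def weights_diff weights_scale weights_plane dual\<close>)
  moreover note coord_normalised[of "s.coord x y" "s.coord y y", folded x'_def y'_def]
    s.coord_normalised[of "coord y x" "coord x x", folded s_eq]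
  ultimately show ?thesis using that vanish by blast
qed

end

section \<open>Recognising the model algebras\<close>

lemma algebra_isomorphic_sym:
  assumes "vector_space s1" "vector_space s2" "algebra_isomorphic s1 b1 s2 b2"
  shows "algebra_isomorphic s2 b2 s1 b1"
proof -
  obtain f where f: "Vector_Spaces.linear s1 s2 f" "bij f" "\<And>u v. f (b1 u v) = b2 (f u) (f v)"
    using assms(3) unfolding algebra_isomorphic_def by blast
  have f_inv: "f (inv f v) = v" "inv f (f u) = u" for u v
    using f(2) by (simp_all add: bij_is_surj surj_f_inv_f bij_is_inj)
  have "Vector_Spaces.linear s2 s1 (inv f)"
    using f(1) f_inv assms(1,2) unfolding Vector_Spaces.linear_iff by metis
  moreover have "inv f (b2 u v) = b1 (inv f u) (inv f v)" for u v
    by (metis f(3) f_inv)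
  ultimately show ?thesis
    unfolding algebra_isomorphic_def using bij_imp_bij_inv[OF f(2)] by blast
qed

lemma (in leibniz_algebra) bracket_sum_left:
  "bracket (\<Sum>i\<in>I. f i) w = (\<Sum>i\<in>I. bracket (f i) w)"
  using module_hom.sum[OF linear_bracket_left[unfolded linear_iff_module_hom]] .

lemma (in leibniz_algebra) bracket_sum_right:
  "bracket w (\<Sum>i\<in>I. f i) = (\<Sum>i\<in>I. bracket w (f i))"
  using module_hom.sum[OF linear_bracket_right[unfolded linear_iff_module_hom]] .

lemma (in leibniz_algebra) isomorphic_to_bracket_of_table:
  fixes e :: "gen \<Rightarrow> 'a"
  assumes indep: "\<And>v :: complex ^ gen. (\<Sum>i\<in>UNIV. scale (v $ i) (e i)) = 0 \<Longrightarrow> v = 0"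
    and span: "\<And>z. \<exists>v :: complex ^ gen. z = (\<Sum>i\<in>UNIV. scale (v $ i) (e i))"
    and table: "\<And>i j. bracket (e i) (e j) = (\<Sum>k\<in>UNIV. scale (T i j $ k) (e k))"
  shows "algebra_isomorphic scale bracket (*s) (bracket_of_table T)"
proof -
  define g :: "complex ^ gen \<Rightarrow> 'a" where "g v = (\<Sum>i\<in>UNIV. scale (v $ i) (e i))" for v
  have lin: "Vector_Spaces.linear (*s) scale g"
    unfolding Vector_Spaces.linear_iff g_def
    using vec.vector_space_axioms vector_space_axioms
    by (simp add: algebra_simps sum.distrib scale_sum_right)
  interpret g: Vector_Spaces.linear "(*s)" scale g by (rule lin)
  have "inj g"
    using indep unfolding g.inj_iff_eq_0 g_def by blast
  moreover have "surj g"
    using span unfolding g_def surj_def by blast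
  moreover have "g (bracket_of_table T u v) = bracket (g u) (g v)" for u v
  proof -
    have "bracket (g u) (g v) = (\<Sum>i\<in>UNIV. \<Sum>j\<in>UNIV. scale (u $ i * v $ j) (bracket (e i) (e j)))"
      unfolding g_def bracket_sum_left bracket_sum_right
      by (simp add: bracket_simps scale_sum_right mult.commute) (rule sum.swap)
    also have "\<dots> = (\<Sum>i\<in>UNIV. \<Sum>j\<in>UNIV. g ((u $ i * v $ j) *s T i j))"
      by (simp add: g.scale) (simp add: g_def table)
    also have "\<dots> = g (bracket_of_table T u v)"
      by (simp add: bracket_of_table_def g.sum)
    finally show ?thesis ..
  qed
  ultimately have "algebra_isomorphic (*s) (bracket_of_table T) scale bracket"
    unfolding algebra_isomorphic_def using lin by (auto simp: bij_def)
  then show ?thesis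
    by (rule algebra_isomorphic_sym[OF vec.vector_space_axioms vector_space_axioms])
qed

text \<open>The weights read off the coordinates along \<open>x\<close> and \<open>y\<close>; what remains lies in the plane.\<close>

lemma (in diagonal_action) isomorphic_to_table:
  assumes T: "\<And>i j. bracket (case_gen e1 e2 x y i) (case_gen e1 e2 x y j) =
      (\<Sum>k\<in>UNIV. scale (T i j $ k) (case_gen e1 e2 x y k))"
  shows "algebra_isomorphic scale bracket (*s) (bracket_of_table T)"
proof (rule isomorphic_to_bracket_of_table[where e = "case_gen e1 e2 x y"])
  fix v :: "complex ^ gen"
  assume "(\<Sum>i\<in>UNIV. scale (v $ i) (case_gen e1 e2 x y i)) = 0"
  then have 0: "scale (v $ E1) e1 + (scale (v $ E2) e2 + (scale (v $ X) x + scale (v $ Y) y)) = 0"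
    by (simp add: UNIV_gen)
  have "v $ X = 0" "v $ Y = 0"
    using arg_cong[OF 0, of \<phi>] arg_cong[OF 0, of \<psi>]
    by (simp_all add: weights_add(1,2) weights_scale(1,2) weights_zero(1,2) weights_plane dual)
  moreover from this have "v $ E1 = 0 \<and> v $ E2 = 0"
    using 0 free by (simp add: free_pair_def)
  ultimately have "v $ i = 0" for i by (cases i) auto
  then show "v = 0" by (simp add: vec_eq_iff)
next
  fix z
  have "z - scale (\<phi> z) x - scale (\<psi> z) y \<in> span {e1, e2}"
    by (rule vanishing_weights) (simp_all add: weights_diff weights_scale dual)
  then obtain \<alpha> \<beta> where "z - scale (\<phi> z) x - scale (\<psi> z) y = scale \<alpha> e1 + scale \<beta> e2"
    unfolding mem_span_pair by blast
  then have "z = scale \<alpha> e1 + (scale \<beta> e2 + (scale (\<phi> z) x + scale (\<psi> z) y))"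
    by (simp add: algebra_simps)
  then have "z = (\<Sum>i\<in>UNIV. scale ((\<chi> i. case_gen \<alpha> \<beta> (\<phi> z) (\<psi> z) i) $ i) (case_gen e1 e2 x y i))"
    by (simp add: UNIV_gen)
  then show "\<exists>v :: complex ^ gen. z = (\<Sum>i\<in>UNIV. scale (v $ i) (case_gen e1 e2 x y i))" by blast
qed (rule T)

text \<open>Independent choices of the left action on \<open>e1\<close> and on \<open>e2\<close> give four tables. The two mixed ones
  are exchanged by interchanging \<open>e1\<close> with \<open>e2\<close> and \<open>x\<close> with \<open>y\<close>, so both give \<open>R3\<close>.\<close>

lemma (in diagonal_action) classification:
  "algebra_isomorphic scale bracket (*s) R1 \<or>
   algebra_isomorphic scale bracket (*s) R2 \<or>
   algebra_isomorphic scale bracket (*s) R3"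
proof -
  obtain x' y' where xy: "diagonal_action scale bracket e1 e2 \<phi> \<psi> x' y'"
    and zero: "bracket x' x' = 0" "bracket x' y' = 0" "bracket y' x' = 0" "bracket y' y' = 0"
    by (rule abelian_complement)
  interpret n: diagonal_action scale bracket e1 e2 \<phi> \<psi> x' y' by (rule xy)
  interpret s: diagonal_action scale bracket e2 e1 \<psi> \<phi> y' x' by (rule n.swap)
  have facts: "bracket e1 z = scale (\<phi> z) e1" "bracket e2 z = scale (\<psi> z) e2" for z
    by (simp_all add: act1 act2)
  note evaluate = UNIV_gen basis_vec_def axis_def facts zero n.dual weights_plane
  consider
    (zero_zero) "\<forall>z. bracket z e1 = 0" "\<forall>z. bracket z e2 = 0"
  | (minus_minus) "\<forall>z. bracket z e1 = - scale (\<phi> z) e1" "\<forall>z. bracket z e2 = - scale (\<psi> z) e2"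
  | (zero_minus) "\<forall>z. bracket z e1 = 0" "\<forall>z. bracket z e2 = - scale (\<psi> z) e2"
  | (minus_zero) "\<forall>z. bracket z e1 = - scale (\<phi> z) e1" "\<forall>z. bracket z e2 = 0"
    using n.left_action_dichotomy s.left_action_dichotomy by blast
  then show ?thesis
  proof cases
    case zero_zero
    have "algebra_isomorphic scale bracket (*s) R1"
      unfolding R1_def
    proof (rule n.isomorphic_to_table)
      fix i j show "bracket (case_gen e1 e2 x' y' i) (case_gen e1 e2 x' y' j) =
          (\<Sum>k\<in>UNIV. scale (table1 i j $ k) (case_gen e1 e2 x' y' k))"
        using zero_zero by (cases i; cases j; simp add: evaluate)
    qed
    then show ?thesis by blast
  next
    case minus_minus
    have "algebra_isomorphic scale bracket (*s) R2"
      unfolding R2_def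
    proof (rule n.isomorphic_to_table)
      fix i j show "bracket (case_gen e1 e2 x' y' i) (case_gen e1 e2 x' y' j) =
          (\<Sum>k\<in>UNIV. scale (table2 i j $ k) (case_gen e1 e2 x' y' k))"
        using minus_minus by (cases i; cases j; simp add: evaluate)
    qed
    then show ?thesis by blast
  next
    case zero_minus
    have "algebra_isomorphic scale bracket (*s) R3"
      unfolding R3_def
    proof (rule n.isomorphic_to_table)
      fix i j show "bracket (case_gen e1 e2 x' y' i) (case_gen e1 e2 x' y' j) =
          (\<Sum>k\<in>UNIV. scale (table3 i j $ k) (case_gen e1 e2 x' y' k))"
        using zero_minus by (cases i; cases j; simp add: evaluate)
    qed
    then show ?thesis by blast
  next
    case minus_zero
    have "algebra_isomorphic scale bracket (*s) R3"
      unfolding R3_def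
    proof (rule s.isomorphic_to_table)
      fix i j show "bracket (case_gen e2 e1 y' x' i) (case_gen e2 e1 y' x' j) =
          (\<Sum>k\<in>UNIV. scale (table3 i j $ k) (case_gen e2 e1 y' x' k))"
        using minus_zero by (cases i; cases j; simp add: evaluate)
    qed
    then show ?thesis by blast
  qed
qed

lemma (in leibniz_algebra) classification_of_four_dim_solvable:
  assumes dim: "dim (UNIV :: 'a set) = 4" and solv: "solvable UNIV"
    and rad: "is_nilradical N" and dim_N: "dim N = 2"
  shows "algebra_isomorphic scale bracket (*s) R1 \<or>
    algebra_isomorphic scale bracket (*s) R2 \<or>
    algebra_isomorphic scale bracket (*s) R3"
proof -
  have "two_sided_ideal N" using rad by (simp add: is_nilradical_def)
  then obtain v1 v2 \<phi> \<psi> \<nu>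
    where N: "N = span {v1, v2}" and tri: "triangular_action scale bracket v1 v2 \<phi> \<psi> \<nu>"
    using solvable_acts_triangularly_on_plane[OF solv] dim_N by metis
  interpret triangular_action scale bracket v1 v2 \<phi> \<psi> \<nu> by (rule tri)
  obtain x y where "\<phi> x = 1" "\<psi> x = 0" "\<phi> y = 0" "\<psi> y = 1"
    using weights_dual_basis solv rad dim unfolding N by blast
  then have "diagonal_action scale bracket v1 (v2 - scale (\<nu> x) v1) \<phi> \<psi> x y"
    using bracket_in_nilradical vanishing_weights_in_nilradical solv rad unfolding N
    by (intro diagonalisable) blast+
  then show ?thesis by (rule diagonal_action.classification)
qed

section \<open>Distinguishing the three algebras\<close>

text \<open>This separates the Lie algebra \<open>R2\<close> from the other two.\<close>

lemma algebra_isomorphic_preserves_alternating: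
  assumes "algebra_isomorphic s1 b1 s2 b2" "\<And>u. b2 u u = 0"
  shows "b1 u u = 0"
proof -
  obtain f where f: "Vector_Spaces.linear s1 s2 f" "bij f" "\<And>u v. f (b1 u v) = b2 (f u) (f v)"
    using assms(1) unfolding algebra_isomorphic_def by blast
  have "f 0 = 0"
    by (rule module_hom.zero[OF f(1)[unfolded linear_iff_module_hom]])
  then have "f (b1 u u) = f 0" using f(3) assms(2) by simp
  then show ?thesis using f(2) by (meson bij_is_inj injD)
qed

text \<open>This separates \<open>R1\<close>, where left multiplications kill all brackets, from \<open>R3\<close>.\<close>

lemma algebra_isomorphic_preserves_left_nil:
  assumes "algebra_isomorphic s1 b1 s2 b2" "\<And>u v w. b1 u (b1 v w) = 0"
  shows "b2 u (b2 v w) = 0"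
proof -
  obtain f where f: "Vector_Spaces.linear s1 s2 f" "bij f" "\<And>u v. f (b1 u v) = b2 (f u) (f v)"
    using assms(1) unfolding algebra_isomorphic_def by blast
  have "f 0 = 0"
    by (rule module_hom.zero[OF f(1)[unfolded linear_iff_module_hom]])
  moreover obtain u' v' w' where "u = f u'" "v = f v'" "w = f w'"
    using f(2) by (meson bij_is_surj surjD)
  ultimately show ?thesis using assms(2) f(3) by metis
qed

theorem theorem3p7:
  "(\<forall>(scale :: complex \<Rightarrow> 'a::ab_group_add \<Rightarrow> 'a) (bracket :: 'a \<Rightarrow> 'a \<Rightarrow> 'a) (N :: 'a set).
      leibniz_algebra scale bracket \<and>
      vector_space.dim scale (UNIV :: 'a set) = 4 \<and>
      leibniz_algebra.solvable scale bracket UNIV \<and>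
      leibniz_algebra.is_nilradical scale bracket N \<and>
      vector_space.dim scale N = 2 \<longrightarrow>
        algebra_isomorphic scale bracket (*s) R1 \<or>
        algebra_isomorphic scale bracket (*s) R2 \<or>
        algebra_isomorphic scale bracket (*s) R3) \<and>
   \<not> algebra_isomorphic (*s) R1 (*s) R2 \<and>
   \<not> algebra_isomorphic (*s) R1 (*s) R3 \<and>
   \<not> algebra_isomorphic (*s) R2 (*s) R3"
proof (intro conjI)
  have sq: "R1 (basis_vec E1 + basis_vec X) (basis_vec E1 + basis_vec X) $ E1 = 1"
    "R3 (basis_vec E1 + basis_vec X) (basis_vec E1 + basis_vec X) $ E1 = 1"
    by (simp_all add: R1_def R3_def bracket_of_table_def UNIV_gen basis_vec_def axis_def)
  have R2: "R2 u u = 0" for u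
    by (simp add: R2_def bracket_of_table_def UNIV_gen basis_vec_def axis_def vec_eq_iff algebra_simps)
  have R1: "R1 u (R1 v w) = 0" for u v w
    by (simp add: R1_def bracket_of_table_def UNIV_gen basis_vec_def axis_def vec_eq_iff)
  have R3: "R3 (basis_vec Y) (R3 (basis_vec E2) (basis_vec Y)) $ E2 = - 1"
    by (simp add: R3_def bracket_of_table_basis_vec)
      (simp add: basis_vec_def axis_def)
  show "\<not> algebra_isomorphic (*s) R1 (*s) R2"
    using algebra_isomorphic_preserves_alternating[of "(*s)" R1 "(*s)" R2] R2 sq(1)
    by (metis zero_index zero_neq_one)
  show "\<not> algebra_isomorphic (*s) R2 (*s) R3"
    using algebra_isomorphic_preserves_alternating[OF algebra_isomorphic_sym[OF vec.vector_space_axioms vec.vector_space_axioms], of R2 R3] R2 sq(2)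
    by (metis zero_index zero_neq_one)
  show "\<not> algebra_isomorphic (*s) R1 (*s) R3"
  proof
    assume "algebra_isomorphic (*s) R1 (*s) R3"
    then have "R3 (basis_vec Y) (R3 (basis_vec E2) (basis_vec Y)) = 0"
      by (rule algebra_isomorphic_preserves_left_nil) (rule R1)
    then show False using R3 by simp
  qed
qed (use leibniz_algebra.classification_of_four_dim_solvable in blast)

end
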